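(* Let $n$ be odd and $e=2^j+1$ for any integer $j\ge1$ (then $\gcd(e,2^n-1)=1$, so $x\mapsto x^{e}$ is a permutation of $\mathbb{F}_{2^n}$). Then $r_e(\rho)=1$ for every $\rho\in\mathbb{F}_{2^n}\setminus\{0,1\}$, where $$r_e(\rho)=\bigl|\{\tau\in\mathbb{F}_{2^n}:\ \tau^{e}+(\tau+1)^{e}+(\tau+\rho)^{e}=0\}\bigr|.$$ Consequently, for $\psi(x)=x^{2^j+1}$ and every $\rho\in\mathbb{F}_{2^n}\setminus\{0,1\}$, $$\sum_{t,a\in\mathbb{F}_{2^n}}\chi\bigl(\psi(t+\rho a)+\psi(t+a)+\psi(t)\bigr)=0.$$
   Context: $\mathbb{F}_{2^n}$ is the field with $2^n$ elements, $\operatorname{Tr}(x)=\sum_{i=0}^{n-1}x^{2^i}$ is the absolute trace, and $\chi(x)=(-1)^{\operatorname{Tr}(x)}$. *)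

theory Defs
  imports Complex_Main
begin

definition abs_trace :: "nat \<Rightarrow> 'a::field \<Rightarrow> 'a" where
  "abs_trace n x = (\<Sum>i<n. x ^ (2 ^ i))"

text \<open>On a field with \<open>2 ^ n\<close> elements the absolute trace takes values in the prime
  subfield \<open>{0, 1}\<close>, which is here a subset of the field itself; \<open>(-1) ^ Tr x\<close> reads
  these two values as exponents.\<close>

definition add_char :: "nat \<Rightarrow> 'a::field \<Rightarrow> int" where
  "add_char n x = (-1) ^ (if abs_trace n x = 0 then 0 else 1)"

definition r_count :: "nat \<Rightarrow> 'a::field \<Rightarrow> nat" where
  "r_count e \<rho> = card {\<tau>. \<tau> ^ e + (\<tau> + 1) ^ e + (\<tau> + \<rho>) ^ e = 0}"

definition psi :: "nat \<Rightarrow> 'a::field \<Rightarrow> 'a" where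
  "psi j x = x ^ (2 ^ j + 1)"

end

theory Submission
  imports Defs "HOL-Number_Theory.Residues"
begin

text \<open>With \<open>q = 2 ^ j\<close>, expanding in characteristic two gives
  \<open>(t + \<rho> a) ^ e + (t + a) ^ e + t ^ e = (t + (1 + \<rho>) a) ^ e + a ^ e (\<rho> ^ q + \<rho>)\<close>.
  As \<open>x \<mapsto> x ^ e\<close> is a permutation, the left-hand side takes every value exactly once
  as \<open>t\<close> varies with \<open>a\<close> fixed. For \<open>a = 1\<close> this is the count; and the character sum
  over \<open>t\<close> vanishes for each single \<open>a\<close>, because \<open>Tr 1 = n = 1\<close> makes \<open>\<chi>\<close> nontrivial.\<close>

text \<open>Modulo a common divisor \<open>d\<close>, \<open>2 ^ j\<close> is -1 and
  \<open>2 ^ n\<close> is 1. Hence \<open>2 ^ (j * n)\<close> is -1, as \<open>n\<close> is odd, and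
  also 1, so \<open>d\<close> divides 2. Since \<open>j \<ge> 1\<close>, \<open>d\<close> then
  divides \<open>2 ^ j\<close> and therefore 1.\<close>

lemma coprime_two_power_plus_one_minus_one:
  fixes n j :: nat
  assumes "odd n" "j \<ge> 1"
  shows "coprime (2 ^ j + 1 :: nat) (2 ^ n - 1)"
proof -
  \<comment> \<open>The integers allow \<open>y = -1\<close> in the divisibility of
    \<open>x ^ n - y ^ n\<close> by \<open>x - y\<close>.\<close>
  have "coprime (2 ^ j + 1 :: int) (2 ^ n - 1)"
  proof (rule coprimeI)
    fix d :: int
    assume d1: "d dvd 2 ^ j + 1" and d2: "d dvd 2 ^ n - 1"
    have "(2 ^ j - (-1)) dvd (2 ^ j) ^ n - (-1 :: int) ^ n"
      by (simp only: power_diff_sumr2 dvd_triv_left)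
    hence "d dvd (2 ^ j) ^ n + 1"
      using d1 \<open>odd n\<close> by (auto intro: dvd_trans)
    moreover have "(2 ^ n - 1) dvd (2 ^ n) ^ j - (1 :: int) ^ j"
      by (simp only: power_diff_sumr2 dvd_triv_left)
    hence "d dvd (2 ^ j) ^ n - 1"
      using d2 by (auto intro: dvd_trans simp: mult.commute simp flip: power_mult)
    ultimately have "d dvd ((2 ^ j) ^ n + 1) - ((2 ^ j) ^ n - 1)"
      by (rule dvd_diff)
    hence "d dvd 2" by simp
    moreover have "d dvd 2 ^ j"
      using \<open>d dvd 2\<close> assms(2) by (metis dvd_power dvd_trans less_eq_Suc_le One_nat_def)
    ultimately show "is_unit d"
      using d1 by (simp add: dvd_add_right_iff)
  qed
  moreover have "int (2 ^ n - 1) = 2 ^ n - 1"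
    by (simp add: of_nat_diff)
  moreover have "int (2 ^ j + 1) = 2 ^ j + 1"
    by simp
  ultimately show ?thesis
    by (metis coprime_int_iff)
qed

text \<open>Multiplication by \<open>x\<close> permutes the nonzero elements, so their product
  absorbs one factor \<open>x\<close> for each of them.\<close>

lemma finite_field_power_card_minus_one:
  fixes x :: "'a::{field,finite}"
  assumes "x \<noteq> 0"
  shows "x ^ (card (UNIV :: 'a set) - 1) = 1"
proof -
  let ?U = "UNIV - {0 :: 'a}"
  have "bij_betw ((*) x) ?U ?U"
    by (rule bij_betwI[where g = "\<lambda>y. y / x"]) (use assms in auto)
  hence "(\<Prod>y\<in>?U. x * y) = (\<Prod>y\<in>?U. y)"
    by (rule prod.reindex_bij_betw)
  hence "x ^ card ?U * (\<Prod>y\<in>?U. y) = (\<Prod>y\<in>?U. y)"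
    by (simp add: prod.distrib)
  moreover have "(\<Prod>y\<in>?U. y) \<noteq> 0" by simp
  ultimately show ?thesis by (simp add: card_Diff_singleton)
qed

lemma inj_power_coprime:
  fixes e :: nat
  assumes "coprime e (card (UNIV :: 'a::{field,finite} set) - 1)" "e > 0"
  shows "inj (\<lambda>x::'a. x ^ e)"
proof (rule injI)
  fix x y :: 'a
  assume eq: "x ^ e = y ^ e"
  show "x = y"
  proof (cases "y = 0")
    case True
    thus ?thesis using eq \<open>e > 0\<close> by (simp add: power_0_left)
  next
    case False
    let ?m = "card (UNIV :: 'a set) - 1"
    from False eq have "x \<noteq> 0" using \<open>e > 0\<close> by (auto simp: power_0_left)
    \<comment> \<open>Modulo \<open>?m\<close>, \<open>u\<close> is an inverse of \<open>e\<close>,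
      so raising to the power \<open>u\<close> undoes the power \<open>e\<close> on nonzero
      elements.\<close>
    obtain u v where uv: "e * u = ?m * v + 1"
      using bezout_nat[of e ?m] assms by (auto simp: coprime_iff_gcd_eq_1)
    have z: "z = (z ^ e) ^ u" if "z \<noteq> 0" for z :: 'a
    proof -
      have "(z ^ e) ^ u = (z ^ ?m) ^ v * z"
        using uv by (simp add: power_add flip: power_mult)
      thus ?thesis using finite_field_power_card_minus_one[OF that] by simp
    qed
    show ?thesis using z[OF False] z[OF \<open>x \<noteq> 0\<close>] eq by metis
  qed
qed

lemma two_eq_0_CHAR_2:
  assumes "CHAR('a::ring_1) = 2"
  shows "(2 :: 'a) = 0"
  using of_nat_CHAR[where 'a = 'a] assms by simp

lemma abs_trace_add:
  fixes x y :: "'a::field"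
  assumes "CHAR('a) = 2"
  shows "abs_trace n (x + y) = abs_trace n x + abs_trace n y"
  using assms by (simp add: abs_trace_def freshmans_dream' sum.distrib)

text \<open>Squaring shifts the exponents \<open>2 ^ i\<close> by one step, and
  \<open>x ^ 2 ^ n = x\<close> closes the cycle. The trace thus equals its own square.\<close>

lemma abs_trace_cases:
  fixes x :: "'a::field"
  assumes char_2: "CHAR('a) = 2" and frob: "x ^ 2 ^ n = x"
  shows "abs_trace n x = 0 \<or> abs_trace n x = 1"
proof -
  have "(abs_trace n x)\<^sup>2 = (\<Sum>i<n. x ^ 2 ^ Suc i)"
    by (simp add: abs_trace_def freshmans_dream_sum char_2 mult.commute flip: power_mult)
  also have "\<dots> = abs_trace n x"
    using sum.lessThan_Suc_shift[of "\<lambda>i. x ^ 2 ^ i" n] frob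
    by (simp add: abs_trace_def)
  finally show ?thesis by (simp add: power2_eq_square)
qed

text \<open>The one case where traces do not add like integers is 1 + 1 = 0, which matches (-1) *
  (-1) = 1.\<close>

lemma add_char_add:
  fixes x y :: "'a::field"
  assumes char_2: "CHAR('a) = 2" and "x ^ 2 ^ n = x" "y ^ 2 ^ n = y"
  shows "add_char n (x + y) = add_char n x * add_char n y"
  using abs_trace_cases[OF assms(1,2)] abs_trace_cases[OF assms(1,3)] two_eq_0_CHAR_2[OF char_2]
  by (auto simp: add_char_def abs_trace_add char_2)

lemma sum_add_char_eq_0:
  assumes char_2: "CHAR('a::{field,finite}) = 2"
    and frob: "\<And>x::'a. x ^ 2 ^ n = x" and "odd n"
  shows "(\<Sum>x\<in>(UNIV :: 'a set). add_char n x) = 0"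
proof -
  from \<open>odd n\<close> obtain k where "n = 2 * k + 1" by (auto elim: oddE)
  hence "abs_trace n (1 :: 'a) = 1"
    using two_eq_0_CHAR_2[OF char_2] by (simp add: abs_trace_def)
  hence char_1: "add_char n (1 :: 'a) = -1" by (simp add: add_char_def)
  \<comment> \<open>Translation by 1 permutes the field and flips every sign, so the integer sum
    equals its own negative.\<close>
  have "(\<Sum>x\<in>(UNIV :: 'a set). add_char n x) = (\<Sum>x\<in>(UNIV :: 'a set). add_char n (x + 1))"
    by (rule sum.reindex_bij_betw[symmetric]) (rule bij_plus_right)
  also have "\<dots> = - (\<Sum>x\<in>(UNIV :: 'a set). add_char n x)"
    by (simp add: add_char_add char_2 frob char_1 sum_negf)
  finally show ?thesis by simp
qed

lemma char_two_three_term_identity: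
  fixes t a \<rho> :: "'a::comm_ring_1"
  assumes char_2: "CHAR('a) = 2" and e: "e = 2 ^ j + 1"
  shows "(t + \<rho> * a) ^ e + (t + a) ^ e + t ^ e
    = (t + (1 + \<rho>) * a) ^ e + a ^ e * (\<rho> ^ 2 ^ j + \<rho>)"
proof -
  have fr: "(x + y) ^ 2 ^ j = x ^ 2 ^ j + y ^ 2 ^ j" for x y :: 'a
    by (rule freshmans_dream') (simp_all add: char_2)
  define T A R where "T = t ^ 2 ^ j" and "A = a ^ 2 ^ j" and "R = \<rho> ^ 2 ^ j"
  \<comment> \<open>Each \<open>e\<close>-th power is a Frobenius image times its base. The explicit
    multiple of 2 makes this an identity of polynomials in any commutative ring; it vanishes in
    characteristic two.\<close>
  have "(T + R * A) * (t + \<rho> * a) + (T + A) * (t + a) + T * t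
      = (T + (1 + R) * A) * (t + (1 + \<rho>) * a) + A * a * (R + \<rho>)
        + 2 * (T * t - A * a * R - A * a * \<rho>)"
    by (simp add: algebra_simps)
  thus ?thesis
    using two_eq_0_CHAR_2[OF char_2]
    by (simp add: e power_add fr power_mult_distrib T_def A_def R_def mult_ac)
qed

theorem theorem9p2:
  fixes n j e :: nat
  assumes card_field: "card (UNIV :: 'a::{field,finite} set) = 2 ^ n"
    and n_odd: "odd n"
    and j_pos: "j \<ge> 1"
    and e_def: "e = 2 ^ j + 1"
  shows "coprime e (2 ^ n - 1)
    \<and> bij (\<lambda>x::'a. x ^ e)
    \<and> (\<forall>\<rho>::'a. \<rho> \<notin> {0, 1} \<longrightarrow> r_count e \<rho> = 1)
    \<and> (\<forall>\<rho>::'a. \<rho> \<notin> {0, 1} \<longrightarrow>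
         (\<Sum>t\<in>UNIV. \<Sum>a\<in>UNIV.
            add_char n (psi j (t + \<rho> * a) + psi j (t + a) + psi j t)) = 0)"
proof -
  have cop: "coprime e (2 ^ n - 1)"
    using coprime_two_power_plus_one_minus_one[OF n_odd j_pos] e_def by simp
  have "CHAR('a) dvd 2 ^ n" and "prime CHAR('a)"
    using CHAR_dvd_CARD[where 'a = 'a] card_field
    by (auto intro!: prime_CHAR_semidom finite_imp_CHAR_pos)
  hence char_2: "CHAR('a) = 2"
    by (metis prime_dvd_power primes_dvd_imp_eq two_is_prime_nat)
  have frob: "x ^ 2 ^ n = x" for x :: 'a
  proof (cases "x = 0")
    case False
    have "x ^ 2 ^ n = x ^ (2 ^ n - 1) * x"
      by (metis One_nat_def pos2 power_minus_mult zero_less_power)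
    thus ?thesis using finite_field_power_card_minus_one[OF False] card_field by simp
  qed simp
  have bij: "bij (\<lambda>x::'a. x ^ e)"
    using inj_power_coprime[where 'a = 'a and e = e] cop card_field e_def
    by (simp add: bij_def finite_UNIV_inj_surj)
  note key = char_two_three_term_identity[OF char_2 e_def]
  have bij_shift: "bij (\<lambda>t::'a. (t + c) ^ e)" for c
    using bij_comp[OF bij_plus_right bij] by (simp add: comp_def)
  have count: "r_count e \<rho> = 1" for \<rho> :: 'a
  proof -
    \<comment> \<open>This is \<open>key\<close> with \<open>a = 1\<close>. Writing the last sum as
      a difference, the same in characteristic two, turns the vanishing into an equation for a
      single \<open>e\<close>-th power.\<close>
    have "\<tau> ^ e + (\<tau> + 1) ^ e + (\<tau> + \<rho>) ^ e
        = (\<tau> + (1 + \<rho>)) ^ e - (\<rho> ^ 2 ^ j + \<rho>)" for \<tau>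
      using key[of \<tau> \<rho> 1] by (simp only: minus_CHAR_2[OF char_2] mult_1_right power_one mult_1_left add_ac)
    hence "{\<tau>. \<tau> ^ e + (\<tau> + 1) ^ e + (\<tau> + \<rho>) ^ e = 0}
        = {\<tau>. (\<tau> + (1 + \<rho>)) ^ e = \<rho> ^ 2 ^ j + \<rho>}"
      by simp
    moreover have "\<exists>!\<tau>. (\<tau> + (1 + \<rho>)) ^ e = \<rho> ^ 2 ^ j + \<rho>"
      using bij_shift by (simp only: bij_iff)
    ultimately show ?thesis by (simp only: r_count_def card_1_singleton_iff One_nat_def) blast
  qed
  have char_sum: "(\<Sum>t\<in>UNIV. \<Sum>a\<in>UNIV.
      add_char n (psi j (t + \<rho> * a) + psi j (t + a) + psi j t)) = 0" for \<rho> :: 'a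
  proof -
    have "(\<Sum>t\<in>UNIV. add_char n (psi j (t + \<rho> * a) + psi j (t + a) + psi j t)) = 0" for a :: 'a
    proof -
      have "(\<Sum>t\<in>UNIV. add_char n (psi j (t + \<rho> * a) + psi j (t + a) + psi j t))
          = (\<Sum>t\<in>UNIV. add_char n ((t + (1 + \<rho>) * a) ^ e))
            * add_char n (a ^ e * (\<rho> ^ 2 ^ j + \<rho>))"
        unfolding psi_def e_def[symmetric] key
        by (simp only: add_char_add[OF char_2 frob frob] sum_distrib_right)
      \<comment> \<open>For fixed \<open>a\<close>, the shifted power map runs once through the
        field, leaving the full character sum.\<close>
      also have "(\<Sum>t\<in>UNIV. add_char n ((t + (1 + \<rho>) * a) ^ e)) = (\<Sum>x\<in>(UNIV::'a set). add_char n x)"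
        by (rule sum.reindex_bij_betw[OF bij_shift])
      finally show ?thesis using sum_add_char_eq_0[OF char_2 frob n_odd] by simp
    qed
    \<comment> \<open>The vanishing is for the sum over \<open>t\<close> with \<open>a\<close>
      fixed, so that sum has to become the inner one.\<close>
    thus ?thesis by (subst sum.swap) simp
  qed
  show ?thesis using cop bij count char_sum by blast
qed

end
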